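(* For all integers $m,n\ge 1$, the independence polynomial $I_{T_{3,m,n}}(t)$ of the tree $T_{3,m,n}$ is unimodal.
   Context: For a finite simple graph $G$, let $i_k$ be the number of independent (stable) sets of $G$ of size $k$ ($i_0=1$), and $\alpha(G)$ the maximum size of an independent set. The independence polynomial is $I_G(t)=\sum_{k=0}^{\alpha(G)} i_k t^k$. A sequence $a_0,\dots,a_N$ is unimodal if there is $j$ with $a_0\le a_1\le\cdots\le a_j\ge a_{j+1}\ge\cdots\ge a_N$; a polynomial is unimodal if its coefficient sequence is. For nonnegative integers $m,n$, the tree $T_{3,m,n}$ has a root $v_0$ with three children $v_1,v_2,v_3$; $v_1$ has three children $v_{11},v_{12},v_{13}$, $v_2$ has $m$ children $v_{21},\dots,v_{2m}$, $v_3$ has $n$ children $v_{31},\dots,v_{3n}$, and each $v_{ij}$ has exactly one further child $v'_{ij}$ (a leaf). (Equivalently: $v_0$ joined to the centers of three spiders with $3$, $m$, $n$ legs of length $2$.) *)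

theory Defs
  imports Main "HOL-Computational_Algebra.Polynomial"
begin

text \<open>A finite simple graph is given by a vertex set V and an edge relation E
  (assumed symmetric and irreflexive where relevant).\<close>

definition indep_set :: "'v set \<Rightarrow> ('v \<Rightarrow> 'v \<Rightarrow> bool) \<Rightarrow> 'v set \<Rightarrow> bool" where
  "indep_set V E S \<longleftrightarrow> S \<subseteq> V \<and> (\<forall>x\<in>S. \<forall>y\<in>S. \<not> E x y)"

definition indep_count :: "'v set \<Rightarrow> ('v \<Rightarrow> 'v \<Rightarrow> bool) \<Rightarrow> nat \<Rightarrow> nat" where
  "indep_count V E k = card {S. indep_set V E S \<and> card S = k}"

definition indep_number :: "'v set \<Rightarrow> ('v \<Rightarrow> 'v \<Rightarrow> bool) \<Rightarrow> nat" where
  "indep_number V E = Max {card S | S. indep_set V E S}"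

definition indep_poly :: "'v set \<Rightarrow> ('v \<Rightarrow> 'v \<Rightarrow> bool) \<Rightarrow> nat poly" where
  "indep_poly V E = (\<Sum>k\<le>indep_number V E. monom (indep_count V E k) k)"

definition unimodal_seq :: "(nat \<Rightarrow> 'a::linorder) \<Rightarrow> nat \<Rightarrow> bool" where
  "unimodal_seq a N \<longleftrightarrow>
     (\<exists>j\<le>N. (\<forall>i<j. a i \<le> a (Suc i)) \<and> (\<forall>i. j \<le> i \<and> i < N \<longrightarrow> a (Suc i) \<le> a i))"

definition unimodal_poly :: "'a::{zero,linorder} poly \<Rightarrow> bool" where
  "unimodal_poly p \<longleftrightarrow> unimodal_seq (coeff p) (degree p)"

datatype tvert = Root | Mid nat | Inner nat nat | Leaf nat nat

definition legs :: "nat \<Rightarrow> nat \<Rightarrow> nat \<Rightarrow> nat" where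
  "legs m n i = (if i = 1 then 3 else if i = 2 then m else n)"

definition T3_verts :: "nat \<Rightarrow> nat \<Rightarrow> tvert set" where
  "T3_verts m n = {Root} \<union> {Mid i | i. i \<in> {1..3}}
     \<union> {Inner i j | i j. i \<in> {1..3} \<and> j \<in> {1..legs m n i}}
     \<union> {Leaf i j | i j. i \<in> {1..3} \<and> j \<in> {1..legs m n i}}"

fun T3_child :: "nat \<Rightarrow> nat \<Rightarrow> tvert \<Rightarrow> tvert \<Rightarrow> bool" where
  "T3_child m n (Mid i) Root = (i \<in> {1..3})"
| "T3_child m n (Inner i j) (Mid i') = (i = i' \<and> i \<in> {1..3} \<and> j \<in> {1..legs m n i})"
| "T3_child m n (Leaf i j) (Inner i' j') = (i = i' \<and> j = j' \<and> i \<in> {1..3} \<and> j \<in> {1..legs m n i})"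
| "T3_child m n _ _ = False"

definition T3_edge :: "nat \<Rightarrow> nat \<Rightarrow> tvert \<Rightarrow> tvert \<Rightarrow> bool" where
  "T3_edge m n x y \<longleftrightarrow> T3_child m n x y \<or> T3_child m n y x"

end

theory Submission
  imports Defs
begin

text \<open>
  Write \<open>a = 1 + 2t\<close>, \<open>b = 1 + t\<close>, \<open>S k = a^k + t b^k\<close> and \<open>N = m + n + 3\<close>. Distinguishing whether the
  root is taken, the independence polynomial is \<open>F + t a^N\<close> with \<open>F = S 3 * S m * S n\<close>.
  Each \<open>S k\<close> is log-concave, hence so is \<open>F\<close>. The summand \<open>t a^N\<close> peaks at \<open>K + 1\<close>, where
  \<open>K = \<lfloor>(2N + 1) / 3\<rfloor>\<close>, and a sum of two unimodal sequences whose peaks differ by at most one is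
  unimodal. So it remains to see that \<open>F\<close> peaks in \<open>{K, K + 1, K + 2}\<close>, i.e. that \<open>F\<close> increases from
  \<open>K - 1\<close> to \<open>K\<close> and decreases from \<open>K + 2\<close> to \<open>K + 3\<close>.

  Expand \<open>F\<close> into eight terms \<open>t^l a^i b^j\<close> with \<open>i + j = N\<close>. The coefficients of \<open>g = a^i b^j\<close> satisfy a
  three-term recurrence, which combined with log-concavity gives
  \<open>g (k + 1) \<le> g k\<close> as soon as \<open>6k \<ge> 4i + 3j + 1\<close>, and bounds a possible decrease by
  \<open>2 (i + j + 1 - k) (g (k - 1) - g k) \<le> max 0 (6k - (4i + 3j + 1)) * g k\<close>.
  At \<open>K\<close> the increase of the main term \<open>a^N\<close> outweighs all such losses, because
  the coefficients of \<open>a^i b^j\<close> are there at most \<open>(3/4)^j\<close> times those of \<open>a^(i + j)\<close>.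
\<close>

subsection \<open>Log-concave polynomials\<close>


text \<open>Nonnegativity of the 2x2 minors of the Toeplitz matrix of the coefficients. Unlike the
  condition on three adjacent coefficients, it also excludes internal zeros.\<close>

definition log_concave :: "real poly \<Rightarrow> bool" where
  "log_concave p \<longleftrightarrow> (\<forall>i. 0 \<le> coeff p i) \<and>
     (\<forall>i j d. i \<le> j \<longrightarrow> coeff p i * coeff p (j + d) \<le> coeff p (i + d) * coeff p j)"

lemma log_concave_nonneg: "log_concave p \<Longrightarrow> 0 \<le> coeff p i"
  by (simp add: log_concave_def)

lemma log_concaveD:
  "log_concave p \<Longrightarrow> i \<le> j \<Longrightarrow> coeff p i * coeff p (j + d) \<le> coeff p (i + d) * coeff p j"
  by (simp add: log_concave_def)

text \<open>Extension by zero to negative indices: convolutions at shifted indices can then be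
  summed over one common integer range.\<close>

definition zcoeff :: "real poly \<Rightarrow> int \<Rightarrow> real" where
  "zcoeff p z = (if z < 0 then 0 else coeff p (nat z))"

lemma zcoeff_of_nat [simp]: "zcoeff p (int n) = coeff p n"
  by (simp add: zcoeff_def)

lemma zcoeff_log_concave:
  assumes "log_concave p" "s \<le> v" "0 \<le> e"
  shows "zcoeff p s * zcoeff p (v + e) \<le> zcoeff p (s + e) * zcoeff p v"
proof (cases "s < 0")
  case True
  then show ?thesis
    using log_concave_nonneg[OF assms(1)] by (simp add: zcoeff_def)
next
  case False
  then obtain i j d where "s = int i" "v = int j" "e = int d"
    using assms(2,3) by (metis nonneg_int_cases not_less order_trans)
  then show ?thesis
    using log_concaveD[OF assms(1), of i j d] assms(2)
    by (simp flip: of_nat_add)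
qed

text \<open>The shift \<open>d\<close> is put on the index of \<open>q\<close> only, so the four
  coefficients in a minor of a product become sums over the same \<open>z\<close>. Outside
  \<open>{-d..n}\<close> one factor vanishes, so any larger range serves.\<close>

lemma zcoeff_mult:
  assumes "lo \<le> - d" "n \<le> hi" "0 \<le> n" "0 \<le> d"
  shows "zcoeff (p * q) (n + d) = (\<Sum>z\<in>{lo..hi}. zcoeff p (n - z) * zcoeff q (z + d))"
proof -
  have "zcoeff (p * q) (n + d) = (\<Sum>i\<le>nat (n + d). coeff p i * coeff q (nat (n + d) - i))"
    using assms by (simp add: zcoeff_def coeff_mult)
  also have "\<dots> = (\<Sum>z\<in>{-d..n}. zcoeff p (n - z) * zcoeff q (z + d))"
  proof (rule sum.reindex_bij_witness[of _ "\<lambda>z. nat (n - z)" "\<lambda>i. n - int i"])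
    fix i assume i: "i \<in> {..nat (n + d)}"
    then have "n - int i + d = int (nat (n + d) - i)" using assms by auto
    then show "zcoeff p (n - (n - int i)) * zcoeff q (n - int i + d) =
        coeff p i * coeff q (nat (n + d) - i)"
      by (simp only: zcoeff_of_nat diff_diff_eq2 add_diff_cancel_left')
  qed (use assms in auto)
  also have "\<dots> = (\<Sum>z\<in>{lo..hi}. zcoeff p (n - z) * zcoeff q (z + d))"
    using assms by (intro sum.mono_neutral_left) (auto simp: zcoeff_def)
  finally show ?thesis .
qed

text \<open>By the Cauchy--Binet identity, twice the difference of the two sides is the sum over all
  \<open>p\<close>, \<open>q\<close> of products of the \<open>2 \<times> 2\<close> minors with columns \<open>p\<close>, \<open>q\<close>.\<close>

lemma Cauchy_Binet_ineq:
  fixes x y u w :: "'a::linorder \<Rightarrow> real"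
  assumes "\<And>p q. p < q \<Longrightarrow> x q * y p \<le> x p * y q"
    and "\<And>p q. p < q \<Longrightarrow> u p * w q \<le> w p * u q"
  shows "(\<Sum>p\<in>Z. x p * u p) * (\<Sum>q\<in>Z. y q * w q) \<le> (\<Sum>p\<in>Z. x p * w p) * (\<Sum>q\<in>Z. y q * u q)"
proof -
  let ?D = "\<Sum>p\<in>Z. \<Sum>q\<in>Z. x p * y q * (w p * u q - u p * w q)"
  have D: "(\<Sum>p\<in>Z. x p * w p) * (\<Sum>q\<in>Z. y q * u q) - (\<Sum>p\<in>Z. x p * u p) * (\<Sum>q\<in>Z. y q * w q) = ?D"
    unfolding sum_product by (simp add: algebra_simps flip: sum_subtractf)
  have "2 * ?D = ?D + (\<Sum>p\<in>Z. \<Sum>q\<in>Z. x q * y p * (w q * u p - u q * w p))"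
    by (subst (3) sum.swap) simp
  also have "\<dots> = (\<Sum>p\<in>Z. \<Sum>q\<in>Z. (x p * y q - x q * y p) * (w p * u q - u p * w q))"
    by (simp add: algebra_simps flip: sum.distrib)
  also have "\<dots> \<ge> 0"
  proof (intro sum_nonneg)
    fix p q
    show "0 \<le> (x p * y q - x q * y p) * (w p * u q - u p * w q)"
    proof (cases p q rule: linorder_cases)
      case less
      then show ?thesis using assms(1)[of p q] assms(2)[of p q] by simp
    next
      case greater
      then show ?thesis using assms(1)[of q p] assms(2)[of q p]
        by (intro mult_nonpos_nonpos) (simp_all add: mult.commute)
    qed simp
  qed
  finally show ?thesis using D by linarith
qed

text \<open>A minor of the product is a determinant of inner products of two shifted copies of
  \<open>p\<close> with two shifted copies of \<open>q\<close>. Log-concavity of each factor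
  supplies the sign conditions of \<open>Cauchy_Binet_ineq\<close>.\<close>

lemma log_concave_mult:
  assumes "log_concave p" "log_concave q"
  shows "log_concave (p * q)"
  unfolding log_concave_def
proof (intro conjI allI impI)
  show "0 \<le> coeff (p * q) i" for i
    using assms by (simp add: coeff_mult sum_nonneg log_concave_nonneg)
next
  fix i j d :: nat
  assume ij: "i \<le> j"
  let ?Z = "{- int d..int j}"
  let ?x = "\<lambda>z. zcoeff p (int i - z)" and ?y = "\<lambda>z. zcoeff p (int j - z)"
  let ?u = "\<lambda>z. zcoeff q z" and ?w = "\<lambda>z. zcoeff q (z + int d)"
  have "(\<Sum>z\<in>?Z. ?x z * ?u z) * (\<Sum>z\<in>?Z. ?y z * ?w z) \<le> (\<Sum>z\<in>?Z. ?x z * ?w z) * (\<Sum>z\<in>?Z. ?y z * ?u z)"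
  proof (rule Cauchy_Binet_ineq)
    fix r s :: int assume "r < s"
    then show "?x s * ?y r \<le> ?x r * ?y s"
      using zcoeff_log_concave[OF assms(1), of "int i - s" "int j - s" "s - r"] ij by simp
    show "?u r * ?w s \<le> ?w r * ?u s"
      using zcoeff_log_concave[OF assms(2), of r s "int d"] \<open>r < s\<close> by simp
  qed
  moreover have "(\<Sum>z\<in>?Z. ?x z * ?u z) = coeff (p * q) i"
    using zcoeff_mult[of "- int d" 0 "int i" "int j" p q] ij by simp
  moreover have "(\<Sum>z\<in>?Z. ?y z * ?u z) = coeff (p * q) j"
    using zcoeff_mult[of "- int d" 0 "int j" "int j" p q] by simp
  moreover have "(\<Sum>z\<in>?Z. ?x z * ?w z) = coeff (p * q) (i + d)"
    using zcoeff_mult[of "- int d" "int d" "int i" "int j" p q] ij by (simp flip: of_nat_add)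
  moreover have "(\<Sum>z\<in>?Z. ?y z * ?w z) = coeff (p * q) (j + d)"
    using zcoeff_mult[of "- int d" "int d" "int j" "int j" p q] by (simp flip: of_nat_add)
  ultimately show "coeff (p * q) i * coeff (p * q) (j + d) \<le> coeff (p * q) (i + d) * coeff (p * q) j"
    by simp
qed

lemma log_concave_linear:
  assumes "0 \<le> c"
  shows "log_concave [:1, c:]"
  using assms by (auto simp: log_concave_def coeff_pCons split: nat.splits)

lemma log_concave_power: "log_concave p \<Longrightarrow> log_concave (p ^ n)"
proof (induction n)
  case 0
  then show ?case using log_concave_linear[of 0] by (simp add: one_pCons)
qed (simp add: log_concave_mult)

text \<open>Ratios of consecutive coefficients decrease, and chaining these comparisons gives all
  minors. Positivity up to \<open>d\<close> permits the cancellations; once the largest index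
  exceeds \<open>d\<close>, the smaller product is zero.\<close>

lemma log_concave_if_adjacent:
  assumes pos: "\<And>i. i \<le> d \<Longrightarrow> 0 < coeff p i" and zero: "\<And>i. d < i \<Longrightarrow> coeff p i = 0"
    and adj: "\<And>i. Suc i < d \<Longrightarrow> coeff p i * coeff p (Suc (Suc i)) \<le> (coeff p (Suc i))\<^sup>2"
  shows "log_concave p"
proof -
  have nonneg: "0 \<le> coeff p i" for i
    using pos[of i] zero[of i] by (cases "i \<le> d") auto
  have adj': "coeff p i * coeff p (Suc (Suc i)) \<le> (coeff p (Suc i))\<^sup>2" for i
    using adj[of i] zero[of "Suc (Suc i)"] by (cases "Suc i < d") auto
  have step: "coeff p i * coeff p (Suc j) \<le> coeff p (Suc i) * coeff p j" if "i \<le> j" for i j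
    using that
  proof (induction j rule: dec_induct)
    case base
    then show ?case by simp
  next
    case (step j)
    show ?case
    proof (cases "Suc (Suc j) \<le> d")
      case True
      then have j: "0 < coeff p j" using pos[of j] by simp
      have "coeff p j * (coeff p i * coeff p (Suc (Suc j))) \<le> coeff p i * (coeff p (Suc j))\<^sup>2"
        using mult_left_mono[OF adj'[of j] nonneg[of i]] by (simp add: mult_ac)
      also have "\<dots> \<le> coeff p j * (coeff p (Suc i) * coeff p (Suc j))"
        using mult_right_mono[OF step.IH nonneg[of "Suc j"]] by (simp add: power2_eq_square mult_ac)
      finally show ?thesis using j by simp
    next
      case False
      then show ?thesis using zero[of "Suc (Suc j)"] nonneg by simp
    qed
  qed
  have "coeff p i * coeff p (j + e) \<le> coeff p (i + e) * coeff p j" if ij: "i \<le> j" for i j e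
  proof (induction e)
    case (Suc e)
    show ?case
    proof (cases "j + Suc e \<le> d")
      case True
      then have P: "0 < coeff p (i + e) * coeff p (j + e)" using pos ij by simp
      \<comment> \<open>The bound for shift \<open>e\<close> times the one-step bound at
        \<open>i + e\<close>, \<open>j + e\<close>; a common positive factor then cancels.\<close>
      have "(coeff p i * coeff p (j + e)) * (coeff p (i + e) * coeff p (Suc (j + e))) \<le>
          (coeff p (i + e) * coeff p j) * (coeff p (Suc (i + e)) * coeff p (j + e))"
        using Suc step[of "i + e" "j + e"] ij by (intro mult_mono[of "_ * _" "_ * _"]) (auto simp: nonneg)
      then have "(coeff p (i + e) * coeff p (j + e)) * (coeff p i * coeff p (j + Suc e)) \<le>
          (coeff p (i + e) * coeff p (j + e)) * (coeff p (i + Suc e) * coeff p j)"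
        by (simp add: mult_ac)
      then show ?thesis using P mult_le_cancel_left_pos by blast
    next
      case False
      then show ?thesis using zero[of "j + Suc e"] nonneg by simp
    qed
  qed simp
  with nonneg show ?thesis by (simp add: log_concave_def)
qed

section \<open>Peaks of log-concave sequences and of sums of unimodal sequences\<close>

lemma log_concave_incr:
  assumes "log_concave p" "coeff p k \<le> coeff p (Suc k)" "0 < coeff p (Suc k)" "i \<le> k"
  shows "coeff p i \<le> coeff p (Suc i)"
proof -
  have "coeff p i * coeff p (Suc k) \<le> coeff p (Suc i) * coeff p k"
    using log_concaveD[OF assms(1,4), of 1] by simp
  also have "\<dots> \<le> coeff p (Suc i) * coeff p (Suc k)"
    using assms(2) log_concave_nonneg[OF assms(1)] by (intro mult_left_mono)
  finally show ?thesis using assms(3) by simp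
qed

lemma log_concave_decr:
  assumes "log_concave p" "coeff p (Suc k) \<le> coeff p k" "0 < coeff p k" "k \<le> i"
  shows "coeff p (Suc i) \<le> coeff p i"
proof -
  have "coeff p k * coeff p (Suc i) \<le> coeff p (Suc k) * coeff p i"
    using log_concaveD[OF assms(1,4), of 1] by simp
  also have "\<dots> \<le> coeff p k * coeff p i"
    using assms(2) log_concave_nonneg[OF assms(1)] by (intro mult_right_mono)
  finally show ?thesis using assms(3) by simp
qed

text \<open>One known ascent and one known descent, three steps apart, confine the peak to three
  consecutive positions.\<close>

lemma log_concave_peak:
  assumes "log_concave p" "coeff p k \<le> coeff p (Suc k)" "coeff p (k + 4) \<le> coeff p (k + 3)"
    and pos: "\<And>i. i \<le> k + 3 \<Longrightarrow> 0 < coeff p i"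
  obtains q where "k + 1 \<le> q" "q \<le> k + 3" "\<And>i. i < q \<Longrightarrow> coeff p i \<le> coeff p (Suc i)"
    "\<And>i. q \<le> i \<Longrightarrow> coeff p (Suc i) \<le> coeff p i"
proof -
  \<comment> \<open>The first descent after \<open>k\<close>: minimality gives the ascents strictly
    between \<open>k\<close> and \<open>q\<close>, log-concavity those up to \<open>k\<close> and
    the descents from \<open>q\<close> on.\<close>
  define q where "q = (LEAST q. coeff p (Suc q) \<le> coeff p q \<and> k < q)"
  have ex: "coeff p (Suc (k + 3)) \<le> coeff p (k + 3) \<and> k < k + 3"
    using assms(3) by (simp add: numeral_eq_Suc)
  have q: "coeff p (Suc q) \<le> coeff p q" "k < q" and qle: "q \<le> k + 3"
    unfolding q_def using LeastI[of "\<lambda>q. coeff p (Suc q) \<le> coeff p q \<and> k < q", OF ex]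
      Least_le[of "\<lambda>q. coeff p (Suc q) \<le> coeff p q \<and> k < q", OF ex] by auto
  show ?thesis
  proof (rule that[of q])
    show "coeff p (Suc i) \<le> coeff p i" if "q \<le> i" for i
      using log_concave_decr[OF assms(1) q(1) _ that] pos[OF qle] by simp
    show "coeff p i \<le> coeff p (Suc i)" if "i < q" for i
    proof (cases "i \<le> k")
      case True
      then show ?thesis using log_concave_incr[OF assms(1,2)] pos[of "Suc k"] by simp
    next
      case False
      then show ?thesis
        using not_less_Least[of i "\<lambda>q. coeff p (Suc q) \<le> coeff p q \<and> k < q"] that
        unfolding q_def by auto
    qed
  qed (use q qle in auto)
qed

text \<open>Except in the step from \<open>min p q\<close> to its successor, both sequences move in
  the same direction. Whichever way the sum moves in that one step, it has a peak.\<close>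

lemma unimodal_add:
  fixes f g :: "nat \<Rightarrow> real"
  assumes "p \<le> Suc q" "q \<le> Suc p"
    and f: "\<And>i. i < p \<Longrightarrow> f i \<le> f (Suc i)" "\<And>i. p \<le> i \<Longrightarrow> f (Suc i) \<le> f i"
    and g: "\<And>i. i < q \<Longrightarrow> g i \<le> g (Suc i)" "\<And>i. q \<le> i \<Longrightarrow> g (Suc i) \<le> g i"
  obtains j where "\<And>i. i < j \<Longrightarrow> f i + g i \<le> f (Suc i) + g (Suc i)"
    "\<And>i. j \<le> i \<Longrightarrow> f (Suc i) + g (Suc i) \<le> f i + g i"
proof -
  let ?lo = "min p q"
  have inc: "f i + g i \<le> f (Suc i) + g (Suc i)" if "i < ?lo" for i
    using that f(1) g(1) by (intro add_mono) auto
  have dec: "f (Suc i) + g (Suc i) \<le> f i + g i" if "max p q \<le> i" for i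
    using that f(2) g(2) by (intro add_mono) auto
  have mid: "max p q \<le> i" if "Suc ?lo \<le> i" for i
    using assms(1,2) that by auto
  show ?thesis
  proof (cases "f ?lo + g ?lo \<le> f (Suc ?lo) + g (Suc ?lo)")
    case True
    show ?thesis
    proof (rule that[of "Suc ?lo"])
      show "f i + g i \<le> f (Suc i) + g (Suc i)" if "i < Suc ?lo" for i
        using that inc[of i] True less_antisym by blast
      show "f (Suc i) + g (Suc i) \<le> f i + g i" if "Suc ?lo \<le> i" for i
        using dec mid that by blast
    qed
  next
    case False
    show ?thesis
    proof (rule that[of ?lo])
      show "f (Suc i) + g (Suc i) \<le> f i + g i" if "?lo \<le> i" for i
      proof (cases "i = ?lo")
        case True
        then show ?thesis using False by simp
      next
        case neq: False
        then have "Suc ?lo \<le> i" using that by simp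
        then show ?thesis using dec mid by blast
      qed
    qed (rule inc)
  qed
qed

subsection \<open>Coefficients of products of powers of \<open>1 + 2t\<close> and \<open>1 + t\<close>\<close>

lemma coeff_one_linear_power: "coeff ([:1, c:] ^ n) k = real (n choose k) * c ^ k"
proof (cases "k \<le> n")
  case True
  then show ?thesis by (simp add: coeff_linear_poly_power)
next
  case False
  then have "degree ([:1, c:] ^ n) < k"
    using degree_power_le[of "[:1, c:]" n] degree_pCons_le[of 1 "[:c:]"] by (auto simp: not_le elim!: le_less_trans)
  with False show ?thesis by (simp add: coeff_eq_0)
qed

lemma of_nat_binomial_Suc:
  "real (Suc k) * real (m choose Suc k) = (real m - real k) * real (m choose k)"
proof (cases "k \<le> m")
  case True
  then have "Suc k * (m choose Suc k) = (m - k) * (m choose k)"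
    by (metis binomial_absorb_comp binomial_absorption)
  then show ?thesis using True by (metis of_nat_diff of_nat_mult)
qed (simp add: binomial_eq_0)

abbreviation bilin :: "nat \<Rightarrow> nat \<Rightarrow> real poly" where
  "bilin i j \<equiv> [:1, 2:] ^ i * [:1, 1:] ^ j"

lemma log_concave_bilin: "log_concave (bilin i j)"
  by (intro log_concave_mult log_concave_power log_concave_linear) auto

text \<open>The logarithmic derivative of the power, with its denominator cleared.\<close>

lemma pderiv_linear_power:
  fixes c :: real
  shows "pderiv ([:1, c:] ^ n) * [:1, c:] = smult (real n * c) ([:1, c:] ^ n)"
proof (cases n)
  case (Suc k)
  then show ?thesis by (simp add: pderiv_power_Suc pderiv_pCons mult_ac del: power_Suc) (simp add: mult_ac)
qed simp

text \<open>Clearing denominators in \<open>g' / g = 2i / (1 + 2t) + j / (1 + t)\<close> gives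
  \<open>g' (1 + 3t + 2t^2) = g (2i + j + 2(i + j)t)\<close>; the coefficients of
  \<open>t^(k + 1)\<close> are compared.\<close>

lemma bilin_recurrence:
  "real (k + 2) * coeff (bilin i j) (Suc (Suc k)) =
    (2 * real i + real j - 3 * real (Suc k)) * coeff (bilin i j) (Suc k) +
    2 * (real i + real j - real k) * coeff (bilin i j) k"
proof -
  let ?g = "bilin i j"
  have "pderiv ?g * ([:1, 2:] * [:1, 1:]) =
      (pderiv ([:1, 2:] ^ i) * [:1, 2:]) * [:1, 1:] ^ j * [:1, 1:] +
      [:1, 2:] ^ i * (pderiv ([:1, 1:] ^ j) * [:1, 1:]) * [:1, 2:]"
    by (simp only: pderiv_mult algebra_simps)
  also have "\<dots> = ?g * [:2 * real i + real j, 2 * (real i + real j):]"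
    unfolding pderiv_linear_power
    by (simp add: poly_eq_iff coeff_pCons algebra_simps split: nat.split)
  finally have "coeff (pderiv ?g * [:1, 3, 2:]) (Suc k) =
      coeff (?g * [:2 * real i + real j, 2 * (real i + real j):]) (Suc k)"
    by simp
  then show ?thesis
    by (cases k) (simp_all add: coeff_pderiv algebra_simps)
qed

text \<open>Since \<open>1 + 2t = 2(1 + t) - 1\<close>, the product \<open>g' (1 + 2t)\<close> falls
  short of \<open>2(i + j) g\<close> by \<open>j a^i b^(j - 1)\<close>, whose coefficients are
  nonnegative.\<close>

lemma bilin_ratio_le:
  "real (Suc k) * coeff (bilin i j) (Suc k) \<le> 2 * (real i + real j - real k) * coeff (bilin i j) k"
proof -
  let ?g = "bilin i j" and ?r = "smult (real j) (bilin i (j - 1))"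
  have b: "pderiv ([:1, 1:] ^ j) * [:1, 2:] + smult (real j) ([:1, 1:] ^ (j - 1)) =
      smult (2 * real j) ([:1, 1:] ^ j)"
  proof (cases j)
    case (Suc l)
    have "pderiv ([:1, 1:] ^ j) = smult (real j) ([:1, 1::real:] ^ l)"
      by (simp add: Suc pderiv_power_Suc pderiv_pCons del: power_Suc)
    then have "pderiv ([:1, 1:] ^ j) * [:1, 2:] + smult (real j) ([:1, 1:] ^ (j - 1)) =
        smult (real j) ([:1, 1:] ^ l * ([:1, 2:] + 1))"
      by (simp only: Suc diff_Suc_1 distrib_left mult_1_right smult_add_right mult_smult_left)
    also have "[:1, 2:] + 1 = smult 2 [:1, 1::real:]" by (simp add: one_pCons)
    finally show ?thesis
      by (simp only: Suc power_Suc mult_smult_right smult_smult mult.commute)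
  qed simp
  have "pderiv ?g * [:1, 2:] + ?r =
      (pderiv ([:1, 2:] ^ i) * [:1, 2:]) * [:1, 1:] ^ j +
      [:1, 2:] ^ i * (pderiv ([:1, 1:] ^ j) * [:1, 2:] + smult (real j) ([:1, 1:] ^ (j - 1)))"
    by (simp only: pderiv_mult algebra_simps mult_smult_right)
  also have "\<dots> = smult (2 * (real i + real j)) ?g"
    unfolding pderiv_linear_power b by (simp add: algebra_simps smult_add_left)
  finally have "coeff (pderiv ?g * [:1, 2:]) k + coeff ?r k = 2 * (real i + real j) * coeff ?g k"
    by (metis coeff_add coeff_smult)
  moreover have "0 \<le> coeff ?r k"
    using log_concave_nonneg[OF log_concave_bilin] by simp
  moreover have "coeff (pderiv ?g * [:1, 2:]) k = real (Suc k) * coeff ?g (Suc k) + 2 * real k * coeff ?g k"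
    by (cases k) (simp_all add: coeff_pderiv algebra_simps)
  ultimately show ?thesis by (simp add: algebra_simps)
qed

text \<open>For \<open>k\<close> at most \<open>i + j\<close> both differences carry nonnegative
  weights, so the sign of the linear factor on the right locates the peak.\<close>

lemma bilin_diff_recurrence:
  fixes i j k :: nat
  defines "c \<equiv> coeff (bilin i j)"
  shows "real (k + 2) * (c (Suc (Suc k)) - c (Suc k)) + 2 * (real i + real j - real k) * (c (Suc k) - c k) =
    (4 * real i + 3 * real j + 1 - 6 * real (Suc k)) * c (Suc k)"
  using bilin_recurrence[of k i j] unfolding c_def by (simp add: algebra_simps)

text \<open>By log-concavity a strict ascent at \<open>k\<close> comes after a weak ascent at
  \<open>k - 1\<close>. The left side of the difference recurrence would then be positive, while the
  hypothesis makes its right side at most zero.\<close>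

lemma bilin_decr:
  assumes "4 * i + 3 * j + 1 \<le> 6 * k"
  shows "coeff (bilin i j) (Suc k) \<le> coeff (bilin i j) k"
proof (rule ccontr)
  let ?c = "coeff (bilin i j)"
  assume "\<not> ?c (Suc k) \<le> ?c k"
  then have up: "?c k < ?c (Suc k)" by simp
  obtain l where k: "k = Suc l" using assms by (cases k) auto
  have nn: "0 \<le> ?c n" for n by (rule log_concave_nonneg[OF log_concave_bilin])
  \<comment> \<open>The strict ascent forces a nonzero coefficient at \<open>Suc k\<close>, hence an
    index within the degree; this keeps the weight \<open>i + j - l\<close> nonnegative.\<close>
  have "Suc k \<le> i + j"
  proof (rule ccontr)
    assume "\<not> Suc k \<le> i + j"
    then have "degree (bilin i j) < Suc k"
      using degree_mult_le[of "[:1, 2:] ^ i" "[:1, 1::real:] ^ j"]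
      by (simp add: degree_power_eq)
    then show False using up nn[of k] by (simp add: coeff_eq_0)
  qed
  have "?c l * ?c (Suc k) \<le> ?c k * ?c k"
    using log_concaveD[OF log_concave_bilin, of l k i j 1] k by simp
  also have "\<dots> \<le> ?c k * ?c (Suc k)" using up nn by (intro mult_left_mono) auto
  finally have "?c l \<le> ?c k" using up nn[of k] by simp
  then have "0 \<le> 2 * (real i + real j - real l) * (?c k - ?c l)"
    using \<open>Suc k \<le> i + j\<close> k by simp
  moreover have "0 < real (l + 2) * (?c (Suc k) - ?c k)" using up by simp
  moreover have "(4 * real i + 3 * real j + 1 - 6 * real (Suc l)) * ?c k \<le> 0"
    using assms nn k by (intro mult_nonpos_nonneg) auto
  ultimately show False using bilin_diff_recurrence[of l i j] k by simp
qed

lemma bilin_incr_bound: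
  assumes "k \<le> i + j"
  shows "- max 0 (6 * real (Suc k) - (4 * real i + 3 * real j + 1)) * coeff (bilin i j) (Suc k) \<le>
    2 * (real i + real j - real k) * (coeff (bilin i j) (Suc k) - coeff (bilin i j) k)"
proof (cases "coeff (bilin i j) k \<le> coeff (bilin i j) (Suc k)")
  let ?c = "coeff (bilin i j)"
  have nn: "0 \<le> ?c n" for n by (rule log_concave_nonneg[OF log_concave_bilin])
  case True
  then have "0 \<le> 2 * (real i + real j - real k) * (?c (Suc k) - ?c k)"
    using assms by simp
  moreover have "- max 0 (6 * real (Suc k) - (4 * real i + 3 * real j + 1)) * ?c (Suc k) \<le> 0"
    using nn by (intro mult_nonpos_nonneg) auto
  ultimately show ?thesis by linarith
next
  let ?c = "coeff (bilin i j)"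
  have nn: "0 \<le> ?c n" for n by (rule log_concave_nonneg[OF log_concave_bilin])
  case False
  then have "?c (Suc (Suc k)) \<le> ?c (Suc k)"
    using log_concave_decr[OF log_concave_bilin, of i j k "Suc k"] nn[of "Suc k"] by simp
  then have "real (k + 2) * (?c (Suc (Suc k)) - ?c (Suc k)) \<le> 0"
    by (intro mult_nonneg_nonpos) auto
  then have "(4 * real i + 3 * real j + 1 - 6 * real (Suc k)) * ?c (Suc k) \<le>
      2 * (real i + real j - real k) * (?c (Suc k) - ?c k)"
    using bilin_diff_recurrence[of k i j] by linarith
  moreover have "- max 0 (6 * real (Suc k) - (4 * real i + 3 * real j + 1)) * ?c (Suc k) \<le>
      (4 * real i + 3 * real j + 1 - 6 * real (Suc k)) * ?c (Suc k)"
    using nn by (intro mult_right_mono) auto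
  ultimately show ?thesis by linarith
qed

text \<open>Factors \<open>1 + t\<close> are traded for \<open>1 + 2t\<close> one at a time. Each
  trade compares \<open>g k + g (k - 1)\<close> with \<open>g k + 2 g (k - 1)\<close>, and the
  quotient is at most 3/4 when \<open>g k \<le> 2 g (k - 1)\<close>, which
  \<open>bilin_ratio_le\<close> gives at or beyond half of the degree.\<close>

lemma bilin_le_power:
  assumes "p + q \<le> 2 * k"
  shows "coeff (bilin p q) k \<le> (3/4) ^ q * coeff ([:1, 2:] ^ (p + q)) k"
  using assms
proof (induction q arbitrary: p)
  case 0
  then show ?case by simp
next
  case (Suc q)
  let ?g = "bilin p q"
  obtain l where k: "k = Suc l" using Suc.prems by (cases k) auto
  have "real (Suc l) * coeff ?g (Suc l) \<le> 2 * (real p + real q - real l) * coeff ?g l"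
    by (rule bilin_ratio_le)
  also have "\<dots> \<le> real (Suc l) * (2 * coeff ?g l)"
  proof -
    have "2 * (real p + real q - real l) \<le> real (Suc l) * 2" using Suc.prems k by simp
    from mult_right_mono[OF this log_concave_nonneg[OF log_concave_bilin]] show ?thesis
      by (simp only: mult.assoc)
  qed
  finally have g: "coeff ?g (Suc l) \<le> 2 * coeff ?g l"
    by (simp only: mult_le_cancel_left_pos of_nat_0_less_iff zero_less_Suc)
  have "coeff (bilin p (Suc q)) k = coeff ([:1, 1:] * ?g) k" by (simp only: power_Suc mult_ac)
  also have "\<dots> = coeff ?g (Suc l) + coeff ?g l" by (simp add: k)
  also have "\<dots> \<le> 3/4 * (coeff ?g (Suc l) + 2 * coeff ?g l)" using g by simp
  also have "\<dots> = 3/4 * coeff ([:1, 2:] * ?g) k" by (simp add: k)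
  also have "[:1, 2:] * ?g = bilin (Suc p) q" by (simp only: power_Suc mult_ac)
  also have "3/4 * coeff (bilin (Suc p) q) k \<le> 3/4 * ((3/4) ^ q * coeff ([:1, 2:] ^ (Suc p + q)) k)"
    using Suc.prems by (intro mult_left_mono Suc.IH) auto
  finally show ?case by simp
qed

text \<open>The maximum is attained at \<open>y = 3\<close> and \<open>y = 4\<close>; from 3 on the
  step factor \<open>3(y + 1) / (4y)\<close> is at most 1.\<close>

lemma mult_three_quarters_power_le: "real y * (3/4) ^ y \<le> 81/64"
proof (cases "y \<le> 3")
  case True
  then have "y \<in> {0, 1, 2, 3}" by auto
  then show ?thesis by (auto simp: power_numeral_reduce)
next
  case False
  then have "3 \<le> y" by simp
  then show ?thesis
  proof (induction y rule: dec_induct)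
    case (step y)
    have "real (Suc y) * (3/4) ^ Suc y = (real (Suc y) * (3/4)) * (3/4) ^ y" by simp
    also have "\<dots> \<le> real y * (3/4) ^ y" using step.hyps by (intro mult_right_mono) auto
    finally show ?case using step.IH by (rule order_trans)
  qed (simp add: power_numeral_reduce)
qed

lemma shifted_bilin_decr:
  assumes "4 * i + 3 * j + 6 * l + 1 \<le> 6 * k"
  shows "coeff (monom 1 l * bilin i j) (Suc k) \<le> coeff (monom 1 l * bilin i j) k"
  using assms bilin_decr[of i j "k - l"] by (auto simp: coeff_monom_mult Suc_diff_le)

text \<open>The natural weight \<open>i + j + l - k\<close> is replaced by the common weight
  \<open>N - k\<close>, so that the bounds for different terms can be added. Shrinking the weight
  only weakens a decrease.\<close>

lemma shifted_bilin_incr_bound: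
  fixes i j k l :: nat
  defines "p \<equiv> monom 1 l * bilin i j"
  assumes "k \<le> N" "N \<le> i + j + l"
  shows "- max 0 (6 * real (Suc k) - (4 * real i + 3 * real j + 6 * real l + 1)) * coeff p (Suc k) \<le>
    2 * (real N - real k) * (coeff p (Suc k) - coeff p k)" (is "- ?M * _ \<le> _")
proof (cases "l \<le> k")
  case False
  have "0 \<le> coeff p (Suc k)"
    using log_concave_nonneg[OF log_concave_bilin] by (simp add: p_def coeff_monom_mult)
  moreover have "coeff p k = 0" using False by (simp add: p_def coeff_monom_mult)
  ultimately have "0 \<le> 2 * (real N - real k) * (coeff p (Suc k) - coeff p k)"
    using assms(2) by simp
  moreover have "- ?M * coeff p (Suc k) \<le> 0"
    using \<open>0 \<le> coeff p (Suc k)\<close> by (intro mult_nonpos_nonneg) auto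
  ultimately show ?thesis by linarith
next
  case True
  then obtain r where k: "k = l + r" using le_Suc_ex by blast
  have c: "coeff p k = coeff (bilin i j) r" "coeff p (Suc k) = coeff (bilin i j) (Suc r)"
    by (simp_all add: p_def coeff_monom_mult k)
  have "0 \<le> coeff p (Suc k)"
    unfolding c by (rule log_concave_nonneg[OF log_concave_bilin])
  then have neg: "- ?M * coeff p (Suc k) \<le> 0"
    by (intro mult_nonpos_nonneg) auto
  have "6 * real (Suc r) - (4 * real i + 3 * real j + 1) =
      6 * real (Suc k) - (4 * real i + 3 * real j + 6 * real l + 1)"
    by (simp add: k)
  then have *: "- ?M * coeff p (Suc k) \<le> 2 * (real i + real j - real r) * (coeff p (Suc k) - coeff p k)"
    using bilin_incr_bound[of r i j] assms(2,3) k unfolding c by (simp only:)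
  show ?thesis
  proof (cases "coeff p k \<le> coeff p (Suc k)")
    case True
    then have "0 \<le> 2 * (real N - real k) * (coeff p (Suc k) - coeff p k)"
      using assms(2) by simp
    with neg show ?thesis by linarith
  next
    case False
    then have "2 * (real i + real j - real r) * (coeff p (Suc k) - coeff p k) \<le>
        2 * (real N - real k) * (coeff p (Suc k) - coeff p k)"
      using assms(3) k by (intro mult_right_mono_neg) auto
    with * show ?thesis by linarith
  qed
qed

section \<open>The mode of \<open>(1 + 2t)^N\<close> and the losses of the other terms there\<close>

lemma coeff_power_Suc:
  "real (Suc k) * coeff ([:1, 2:] ^ N) (Suc k) = 2 * (real N - real k) * coeff ([:1, 2::real:] ^ N) k"
proof -
  have "real (Suc k) * coeff ([:1, 2:] ^ N) (Suc k) =
      2 * (real (Suc k) * real (N choose Suc k)) * 2 ^ k"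
    by (simp add: coeff_one_linear_power)
  also have "\<dots> = 2 * (real N - real k) * coeff ([:1, 2::real:] ^ N) k"
    unfolding of_nat_binomial_Suc by (simp add: coeff_one_linear_power)
  finally show ?thesis .
qed

lemma coeff_power_nonneg: "0 \<le> coeff ([:1, 2::real:] ^ N) k"
  by (simp add: coeff_one_linear_power)

text \<open>The ratio of consecutive coefficients is \<open>2(N - k) / (k + 1)\<close>, which is at
  least 1 under this hypothesis.\<close>

lemma coeff_power_incr:
  assumes "3 * Suc k \<le> 2 * N + 2"
  shows "coeff ([:1, 2:] ^ N) k \<le> coeff ([:1, 2::real:] ^ N) (Suc k)"
proof -
  have "real (Suc k) * coeff ([:1, 2:] ^ N) k \<le> 2 * (real N - real k) * coeff ([:1, 2::real:] ^ N) k"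
    using assms by (intro mult_right_mono coeff_power_nonneg) auto
  also have "\<dots> = real (Suc k) * coeff ([:1, 2:] ^ N) (Suc k)" by (rule coeff_power_Suc[symmetric])
  finally show ?thesis by (simp only: mult_le_cancel_left_pos of_nat_0_less_iff zero_less_Suc)
qed

lemma coeff_power_decr:
  assumes "2 * N + 2 \<le> 3 * Suc k"
  shows "coeff ([:1, 2:] ^ N) (Suc k) \<le> coeff ([:1, 2::real:] ^ N) k"
proof -
  have "real (Suc k) * coeff ([:1, 2:] ^ N) (Suc k) = 2 * (real N - real k) * coeff ([:1, 2::real:] ^ N) k"
    by (rule coeff_power_Suc)
  also have "\<dots> \<le> real (Suc k) * coeff ([:1, 2:] ^ N) k"
    using assms by (intro mult_right_mono coeff_power_nonneg) auto
  finally show ?thesis by (simp only: mult_le_cancel_left_pos of_nat_0_less_iff zero_less_Suc)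
qed

lemma coeff_power_mono:
  assumes "r \<le> k" "3 * k \<le> 2 * N + 2"
  shows "coeff ([:1, 2:] ^ N) r \<le> coeff ([:1, 2::real:] ^ N) k"
  using assms
proof (induction k rule: dec_induct)
  case (step k)
  then show ?case using coeff_power_incr[of k N] by simp
qed simp

text \<open>Here \<open>6 * Suc k \<le> 4 * N + 2\<close>, so the loss factor is at most
  \<open>j + 1 - 6l\<close>, or zero if that is negative. If it is a positive \<open>y\<close>, the
  coefficient is at most \<open>(3/4)^j\<close> times that of \<open>a^N\<close>; splitting
  \<open>j = y + (6l - 1)\<close> leaves \<open>y (3/4)^y\<close>, at most 81/64.\<close>

lemma shifted_bilin_incr_bound_mode:
  fixes i j k l :: nat
  defines "N \<equiv> i + j" and "p \<equiv> monom 1 l * bilin i j"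
  assumes k: "Suc k = (2 * N + 1) div 3" and "1 \<le> l"
  shows "j < 6 * l \<Longrightarrow> 0 \<le> 2 * (real N - real k) * (coeff p (Suc k) - coeff p k)"
    and "- (81/64 * (3/4) ^ (6 * l - 1)) * coeff ([:1, 2:] ^ N) (Suc k) \<le>
      2 * (real N - real k) * (coeff p (Suc k) - coeff p k)"
proof -
  let ?M = "max 0 (6 * real (Suc k) - (4 * real i + 3 * real j + 6 * real l + 1))"
  let ?h = "coeff ([:1, 2::real:] ^ N) (Suc k)" and ?D = "2 * (real N - real k) * (coeff p (Suc k) - coeff p k)"
  have bound: "- ?M * coeff p (Suc k) \<le> ?D"
    unfolding p_def by (rule shifted_bilin_incr_bound) (use k N_def in auto)
  have "6 * Suc k \<le> 4 * N + 2" using k by simp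
  then have "real (6 * Suc k) \<le> real (4 * (i + j) + 2)"
    unfolding N_def by (simp only: of_nat_le_iff)
  then have "6 * real (Suc k) \<le> 4 * real i + 4 * real j + 2" by simp
  then have M: "?M \<le> max 0 (real j + 1 - 6 * real l)" by simp
  show nonneg: "0 \<le> ?D" if "j < 6 * l"
  proof -
    have "real j + 1 \<le> 6 * real l" using that by linarith
    then have "?M = 0" using M by simp
    then show ?thesis using bound by simp
  qed
  have h: "0 \<le> ?h" by (rule coeff_power_nonneg)
  show "- (81/64 * (3/4) ^ (6 * l - 1)) * ?h \<le> ?D"
  proof (cases "j < 6 * l")
    case True
    have "- (81/64 * (3/4) ^ (6 * l - 1)) * ?h \<le> 0"
      using h by (intro mult_nonpos_nonneg) auto
    then show ?thesis using nonneg[OF True] by linarith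
  next
    case False
    define y where "y = j + 1 - 6 * l"
    have jy: "j = y + (6 * l - 1)" using False assms(4) by (simp add: y_def)
    have My: "?M \<le> real y" using M False by (simp add: y_def of_nat_diff)
    \<comment> \<open>The index is about \<open>2N/3\<close> and \<open>l\<close> is at most
      \<open>j/6\<close>, so the index shifted down by \<open>l\<close> is still at least half of
      \<open>i + j\<close>, as \<open>bilin_le_power\<close> requires.\<close>
    have N: "2 * (i + j) \<le> 3 * Suc k + 1" using k unfolding N_def by presburger
    then have "2 * j \<le> 3 * Suc k + 1" "6 * l \<le> j" using False by simp_all
    with assms(4) have lk: "l \<le> Suc k" by simp
    then obtain s where s: "Suc k = l + s" using le_Suc_ex by blast
    have "3 * (i + j) \<le> 3 * (2 * s) + 2" using N False unfolding s by simp
    then have mid: "i + j \<le> 2 * (Suc k - l)" unfolding s by simp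
    have "coeff p (Suc k) = coeff (bilin i j) (Suc k - l)"
      using lk by (simp add: p_def coeff_monom_mult)
    also have "\<dots> \<le> (3/4) ^ j * coeff ([:1, 2:] ^ N) (Suc k - l)"
      unfolding N_def by (rule bilin_le_power[OF mid])
    also have "\<dots> \<le> (3/4) ^ j * ?h"
      using k by (intro mult_left_mono coeff_power_mono) auto
    finally have p: "coeff p (Suc k) \<le> (3/4) ^ j * ?h" .
    have "?M * coeff p (Suc k) \<le> real y * ((3/4) ^ j * ?h)"
      using My p log_concave_nonneg[OF log_concave_bilin]
      by (intro mult_mono) (auto simp: p_def coeff_monom_mult)
    also have "\<dots> = (real y * (3/4) ^ y) * ((3/4) ^ (6 * l - 1) * ?h)"
      by (simp add: jy power_add)
    also have "\<dots> \<le> 81/64 * ((3/4) ^ (6 * l - 1) * ?h)"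
      using h by (intro mult_right_mono mult_three_quarters_power_le) auto
    finally show ?thesis using bound by simp
  qed
qed

subsection \<open>The product of three spider polynomials\<close>

text \<open>The independence polynomial of the spider with \<open>k\<close> legs of length 2: its
  centre is left out or taken.\<close>

abbreviation spider_poly :: "nat \<Rightarrow> real poly" where
  "spider_poly k \<equiv> [:1, 2:] ^ k + monom 1 1 * [:1, 1:] ^ k"

lemma log_concave_spider:
  "log_concave (spider_poly m)" (is "log_concave ?p")
proof (rule log_concave_if_adjacent)
  have c: "coeff ?p j = (m choose j) * 2 ^ j + (if j = 0 then 0 else m choose (j - 1))" for j
    by (simp add: coeff_one_linear_power coeff_monom_mult)
  show "0 < coeff ?p j" if "j \<le> Suc m" for j
    using that unfolding c by (cases "j = Suc m") (auto intro!: add_pos_nonneg)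
  show "coeff ?p j = 0" if "Suc m < j" for j
    using that unfolding c by (simp add: binomial_eq_0)
  fix i assume "Suc i < Suc m"
  then have im: "Suc i \<le> m" by simp
  \<comment> \<open>With \<open>A + J = m\<close>, the neighbouring binomials become rational
    multiples of \<open>y\<close>; for \<open>i = 0\<close> the value \<open>w = 0\<close> agrees
    with the factor \<open>J - 1\<close>.\<close>
  define A where "A = real m - real (Suc i)"
  define J where "J = real (Suc i)"
  define T where "T = (2::real) ^ Suc i"
  define x y z w where "x = real (m choose Suc i)" and "y = real (m choose i)"
    and "z = real (m choose Suc (Suc i))" and "w = (if i = 0 then 0 else real (m choose (i - 1)))"
  have J: "1 \<le> J" and A: "0 \<le> A" using im by (auto simp: J_def A_def)
  have x: "x = (A + 1) * y / J"
    using of_nat_binomial_Suc[of i m] J by (simp add: x_def y_def A_def J_def field_simps)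
  have z: "z = A * x / (J + 1)"
    using of_nat_binomial_Suc[of "Suc i" m] J by (simp add: x_def z_def A_def J_def field_simps)
  have w: "w = (J - 1) * y / (A + 2)"
  proof (cases i)
    case (Suc k)
    then show ?thesis using of_nat_binomial_Suc[of k m] A by (simp add: w_def y_def A_def J_def field_simps)
  qed (simp add: w_def J_def)
  have y: "0 < y" using im by (simp add: y_def)
  have T: "J \<le> T" unfolding J_def T_def
    by (metis less_imp_le of_nat_less_two_power)
  have xpos: "0 \<le> x" using A J y by (simp add: x)
  have wx: "w * x \<le> y\<^sup>2"
  proof -
    have "(J - 1) * (A + 1) \<le> (A + 2) * J" using A J by (simp add: algebra_simps)
    then have "(J - 1) * (A + 1) / ((A + 2) * J) \<le> 1" using A J by (simp add: divide_le_eq)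
    then have "y\<^sup>2 * ((J - 1) * (A + 1) / ((A + 2) * J)) \<le> y\<^sup>2 * 1"
      by (intro mult_left_mono) auto
    then show ?thesis by (simp add: w x power2_eq_square mult_ac)
  qed
  have zw: "z * w \<le> x * y"
  proof -
    have "A * (J - 1) \<le> (J + 1) * (A + 2)" using A J by (simp add: algebra_simps)
    then have "A * (J - 1) / ((J + 1) * (A + 2)) \<le> 1" using A J by (simp add: divide_le_eq)
    then have "x * y * (A * (J - 1) / ((J + 1) * (A + 2))) \<le> x * y * 1"
      using xpos y by (intro mult_left_mono) auto
    then show ?thesis by (simp add: z w mult_ac)
  qed
  \<comment> \<open>The gap \<open>x^2 - y z\<close> equals
    \<open>x y (A + J + 1) / (J (J + 1))\<close>. Multiplied by \<open>T\<close>, it absorbs the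
    cross term \<open>x y / 2\<close> because \<open>J \<le> T\<close>.\<close>
  have yz: "y * z * T + x * y / 2 \<le> x\<^sup>2 * T"
  proof -
    have "J * (J + 1) \<le> T * (A + J + 1) * 2"
    proof -
      have "J * (J + 1) \<le> T * (A + J + 1)" using T J A by (intro mult_mono) auto
      moreover have "0 \<le> T * (A + J + 1)" using T J A by simp
      ultimately show ?thesis by linarith
    qed
    then have "J * A * T * 2 + J * (J + 1) \<le> (A + 1) * (J + 1) * T * 2"
      by (simp add: algebra_simps)
    then have "(J * A * T * 2 + J * (J + 1)) * (x * y / (2 * J * (J + 1))) \<le>
        ((A + 1) * (J + 1) * T * 2) * (x * y / (2 * J * (J + 1)))"
      using J xpos y by (intro mult_right_mono) auto
    moreover have "(J * A * T * 2 + J * (J + 1)) * (x * y / (2 * J * (J + 1))) = y * z * T + x * y / 2"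
      using J by (simp add: z divide_simps) (simp add: algebra_simps)
    moreover have "((A + 1) * (J + 1) * T * 2) * (x * y / (2 * J * (J + 1))) = x * ((A + 1) * y / J) * T"
      using J by (simp add: divide_simps)
    ultimately show ?thesis by (simp add: power2_eq_square flip: x)
  qed
  \<comment> \<open>Expanded in powers of \<open>T\<close>: \<open>yz\<close> pays for the square
    term and part of the linear one, \<open>zw\<close> for the rest of the linear one,
    \<open>wx\<close> for the constant.\<close>
  have "(y * T / 2 + w) * (z * (2 * T) + x) \<le> (x * T + y)\<^sup>2"
  proof -
    have "T * (y * z * T + x * y / 2) \<le> T * (x\<^sup>2 * T)"
      using yz T J by (intro mult_left_mono) auto
    moreover have "T * (z * w) \<le> T * (x * y)"
      using zw T J by (intro mult_left_mono) auto
    moreover have "0 \<le> T * (x * y)" using T J xpos y by simp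
    ultimately show ?thesis using wx by (simp add: power2_eq_square algebra_simps)
  qed
  then show "coeff ?p i * coeff ?p (Suc (Suc i)) \<le> (coeff ?p (Suc i))\<^sup>2"
    unfolding c x_def y_def z_def w_def T_def by (cases i) (simp_all add: mult_ac add.commute)
qed

lemma spider_product_expand:
  fixes m n :: nat
  shows "spider_poly 3 * spider_poly m * spider_poly n =
    [:1, 2:] ^ (m + n + 3) + monom 1 1 * bilin (m + n) 3 + monom 1 1 * bilin (m + 3) n +
    monom 1 1 * bilin (n + 3) m + monom 1 2 * bilin m (n + 3) + monom 1 2 * bilin n (m + 3) +
    monom 1 2 * bilin 3 (m + n) + monom 1 3 * bilin 0 (m + n + 3)"
proof -
  have "monom (1::real) 2 = monom 1 1 * monom 1 1" "monom (1::real) 3 = monom 1 1 * (monom 1 1 * monom 1 1)"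
    by (simp_all add: mult_monom numeral_eq_Suc)
  then show ?thesis by (simp only: power_add power_0 algebra_simps)
qed

text \<open>After scaling by \<open>2(N - k)\<close>, the main term gains at least
  \<open>?h\<close>. The losses are at most 0.31 twice for \<open>l = 1\<close>, 0.06 three times
  for \<open>l = 2\<close> and 0.01 for \<open>l = 3\<close>, in total 0.81 of
  \<open>?h\<close>.\<close>

lemma spider_product_incr:
  fixes m n :: nat
  defines "F \<equiv> spider_poly 3 * spider_poly m * spider_poly n"
  assumes k: "Suc k = (2 * (m + n + 3) + 1) div 3"
  shows "coeff F k \<le> coeff F (Suc k)"
proof -
  let ?N = "m + n + 3"
  let ?h = "coeff ([:1, 2:] ^ ?N) (Suc k) :: real"
  let ?D = "\<lambda>p::real poly. 2 * (real ?N - real k) * (coeff p (Suc k) - coeff p k)"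
  have piece: "- (81/64 * (3/4) ^ (6 * l - 1)) * ?h \<le> ?D (monom 1 l * bilin i j)"
    if "i + j = ?N" "1 \<le> l" for i j l
    using shifted_bilin_incr_bound_mode(2)[of k i j l] that k by simp
  have "real (Suc k) * ?h = 2 * (real ?N - real k) * coeff ([:1, 2:] ^ ?N) k"
    by (rule coeff_power_Suc)
  then have "?D ([:1, 2:] ^ ?N) = (2 * real ?N + 2 - 3 * real (Suc k)) * ?h"
    by (simp add: algebra_simps)
  moreover have "1 * ?h \<le> (2 * real ?N + 2 - 3 * real (Suc k)) * ?h"
  proof (intro mult_right_mono coeff_power_nonneg)
    have "3 * Suc k \<le> 2 * ?N + 1" using k by simp
    then show "1 \<le> 2 * real ?N + 2 - 3 * real (Suc k)" by linarith
  qed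
  ultimately have main: "?h \<le> ?D ([:1, 2:] ^ ?N)" by simp
  \<comment> \<open>The three legs at the first spider make \<open>j = 3 < 6\<close>, so this term
    loses nothing.\<close>
  have q2: "0 \<le> ?D (monom 1 1 * bilin (m + n) 3)"
    using shifted_bilin_incr_bound_mode(1)[of k "m + n" 3 1] k by simp
  have q3: "- 31/100 * ?h \<le> ?D (monom 1 1 * bilin (m + 3) n)" "- 31/100 * ?h \<le> ?D (monom 1 1 * bilin (n + 3) m)"
    using piece[of "m + 3" n 1] piece[of "n + 3" m 1] coeff_power_nonneg[of ?N "Suc k"]
    by (simp_all add: power_numeral_reduce)
  have q4: "- 6/100 * ?h \<le> ?D (monom 1 2 * bilin m (n + 3))" "- 6/100 * ?h \<le> ?D (monom 1 2 * bilin n (m + 3))"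
     "- 6/100 * ?h \<le> ?D (monom 1 2 * bilin 3 (m + n))"
    using piece[of m "n + 3" 2] piece[of n "m + 3" 2] piece[of 3 "m + n" 2] coeff_power_nonneg[of ?N "Suc k"]
    by (simp_all add: power_numeral_reduce)
  have q6: "- 1/100 * ?h \<le> ?D (monom 1 3 * bilin 0 ?N)"
    using piece[of 0 ?N 3] coeff_power_nonneg[of ?N "Suc k"] by (simp add: power_numeral_reduce)
  have "?D F = ?D ([:1, 2:] ^ ?N) + ?D (monom 1 1 * bilin (m + n) 3) + ?D (monom 1 1 * bilin (m + 3) n) +
      ?D (monom 1 1 * bilin (n + 3) m) + ?D (monom 1 2 * bilin m (n + 3)) +
      ?D (monom 1 2 * bilin n (m + 3)) + ?D (monom 1 2 * bilin 3 (m + n)) + ?D (monom 1 3 * bilin 0 ?N)"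
    unfolding F_def spider_product_expand coeff_add by (simp only: algebra_simps)
  then have "0 \<le> ?D F" using main q2 q3 q4 q6 coeff_power_nonneg[of ?N "Suc k"] by linarith
  moreover have "0 < 2 * (real ?N - real k)" using k by simp
  ultimately show ?thesis by (simp only: zero_le_mult_iff) auto
qed

lemma spider_product_decr:
  fixes m n :: nat
  defines "F \<equiv> spider_poly 3 * spider_poly m * spider_poly n"
  assumes k: "k = (2 * (m + n + 3) + 1) div 3" and mn: "1 \<le> m" "1 \<le> n"
  shows "coeff F (Suc (k + 2)) \<le> coeff F (k + 2)"
proof -
  let ?N = "m + n + 3"
  have k6: "4 * ?N + 10 \<le> 6 * (k + 2)" using k by presburger
  have q1: "coeff ([:1, 2:] ^ ?N) (Suc (k + 2)) \<le> coeff ([:1, 2::real:] ^ ?N) (k + 2)"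
    using k6 by (intro coeff_power_decr) simp
  \<comment> \<open>With \<open>i + j = ?N\<close> and \<open>k6\<close>, the threshold of
    \<open>shifted_bilin_decr\<close> becomes \<open>6l \<le> j + 9\<close>. It fails for
    \<open>l = 2\<close>, \<open>j = m + n\<close> only if \<open>m = n = 1\<close>, which is
    computed directly.\<close>
  have q: "coeff (monom 1 l * bilin i j) (Suc (k + 2)) \<le> coeff (monom 1 l * bilin i j) (k + 2)"
    if "i + j = ?N" "6 * l \<le> j + 9" for i j l
    using that k6 by (intro shifted_bilin_decr) simp
  have q5: "coeff (monom 1 2 * bilin 3 (m + n)) (Suc (k + 2)) \<le> coeff (monom 1 2 * bilin 3 (m + n)) (k + 2)"
  proof (cases "m + n = 2")
    case True
    then have "k = 3" using k by simp
    then show ?thesis unfolding True by (simp add: coeff_monom_mult numeral_eq_Suc)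
  next
    case False
    show ?thesis by (rule q) (use mn False in auto)
  qed
  \<comment> \<open>For \<open>l = 3\<close> the threshold would require \<open>?N \<ge> 9\<close>.
    Instead, the shift by 3 turns the comparison into one of binomials in row \<open>?N\<close> at
    \<open>k - 1\<close> and \<open>k\<close>, where the row no longer increases.\<close>
  have "?N choose k \<le> ?N choose (k - 1)"
    using k mn by (intro binomial_antimono) auto
  then have q6: "coeff (monom 1 3 * bilin 0 ?N) (Suc (k + 2)) \<le> coeff (monom 1 3 * bilin 0 ?N) (k + 2)"
    using k mn by (simp add: coeff_monom_mult coeff_one_linear_power)
  show ?thesis
    unfolding F_def spider_product_expand coeff_add
    using mn by (intro add_mono q1 q5 q6 q) auto
qed

text \<open>The term \<open>a^N\<close> is positive up to degree \<open>N\<close>, and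
  \<open>t^3 b^N\<close> covers the remaining degrees up to \<open>N + 3\<close>.\<close>

lemma spider_product_pos:
  fixes m n :: nat
  defines "F \<equiv> spider_poly 3 * spider_poly m * spider_poly n"
  assumes k: "k \<le> m + n + 6"
  shows "0 < coeff F k"
proof -
  let ?N = "m + n + 3"
  have nn: "0 \<le> coeff (monom 1 l * bilin i j) k" for l i j
    using log_concave_nonneg[OF log_concave_bilin] by (simp add: coeff_monom_mult)
  have "0 < coeff ([:1, 2::real:] ^ ?N) k + coeff (monom 1 3 * bilin 0 ?N) k"
  proof (cases "k \<le> ?N")
    case True
    then have "0 < coeff ([:1, 2::real:] ^ ?N) k" by (simp add: coeff_one_linear_power)
    then show ?thesis using nn[of 3 0 ?N] by linarith
  next
    case False
    then have "0 < coeff (monom 1 3 * bilin 0 ?N) k"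
      using k by (simp add: coeff_monom_mult coeff_one_linear_power)
    then show ?thesis using coeff_power_nonneg[of ?N k] by linarith
  qed
  then show ?thesis
    unfolding F_def spider_product_expand coeff_add
    using nn[of 1 "m + n" 3] nn[of 1 "m + 3" n] nn[of 1 "n + 3" m] nn[of 2 m "n + 3"]
      nn[of 2 n "m + 3"] nn[of 2 3 "m + n"] by linarith
qed

subsection \<open>Generating functions of independent sets\<close>

text \<open>Summing over the sets rather than their sizes turns graph decompositions into bijections
  of summation ranges.\<close>

definition indep_gf :: "'v set \<Rightarrow> ('v \<Rightarrow> 'v \<Rightarrow> bool) \<Rightarrow> real poly" where
  "indep_gf V E = (\<Sum>S | indep_set V E S. monom 1 (card S))"

lemma finite_indep_sets: "finite V \<Longrightarrow> finite {S. indep_set V E S}"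
  by (rule finite_subset[of _ "Pow V"]) (auto simp: indep_set_def)

lemma coeff_indep_gf:
  assumes "finite V"
  shows "coeff (indep_gf V E) k = real (indep_count V E k)"
proof -
  have "coeff (indep_gf V E) k = (\<Sum>S | indep_set V E S. if card S = k then 1 else 0)"
    by (simp add: indep_gf_def coeff_sum)
  also have "\<dots> = (\<Sum>S | indep_set V E S \<and> card S = k. 1)"
    using finite_indep_sets[OF assms, of E]
    by (intro sum.mono_neutral_cong_right) auto
  finally show ?thesis by (simp add: indep_count_def)
qed

text \<open>Truncating at the independence number loses nothing, since no larger independent set
  exists.\<close>

lemma coeff_indep_poly:
  assumes "finite V"
  shows "coeff (indep_poly V E) k = indep_count V E k"
proof (cases "k \<le> indep_number V E")
  case True
  then show ?thesis by (simp add: indep_poly_def coeff_sum)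
next
  case False
  have "finite {card S |S. indep_set V E S}"
    using finite_indep_sets[OF assms, of E] by simp
  then have "card S \<le> indep_number V E" if "indep_set V E S" for S
    unfolding indep_number_def using that by (intro Max_ge) auto
  with False have "{S. indep_set V E S \<and> card S = k} = {}" by auto
  then have "indep_count V E k = 0" unfolding indep_count_def by (simp only: card.empty)
  with False show ?thesis by (simp add: indep_poly_def coeff_sum)
qed

lemma indep_gf_empty [simp]: "indep_gf {} E = 1"
proof -
  have "{S. indep_set {} E S} = {{}}" by (auto simp: indep_set_def)
  then show ?thesis by (simp add: indep_gf_def one_poly_eq_simps monom_0)
qed

lemma indep_gf_union:
  assumes "finite V" "finite W" "V \<inter> W = {}"
    and "\<And>x y. x \<in> V \<Longrightarrow> y \<in> W \<Longrightarrow> \<not> E x y \<and> \<not> E y x"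
  shows "indep_gf (V \<union> W) E = indep_gf V E * indep_gf W E"
proof -
  have "indep_gf V E * indep_gf W E =
    (\<Sum>(S, T) \<in> {S. indep_set V E S} \<times> {T. indep_set W E T}. monom 1 (card S + card T))"
    by (simp add: indep_gf_def sum_product sum.cartesian_product mult_monom)
  also have "\<dots> = indep_gf (V \<union> W) E"
    unfolding indep_gf_def
  proof (rule sum.reindex_bij_witness[of _ "\<lambda>U. (U \<inter> V, U \<inter> W)" "\<lambda>(S, T). S \<union> T"])
    fix p assume p: "p \<in> {S. indep_set V E S} \<times> {T. indep_set W E T}"
    then obtain S T where [simp]: "p = (S, T)" and ST: "S \<subseteq> V" "T \<subseteq> W"
      by (cases p) (auto simp: indep_set_def)
    show "(case p of (S, T) \<Rightarrow> S \<union> T) \<in> {U. indep_set (V \<union> W) E U}"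
      using p assms(4) by (auto simp: indep_set_def) blast+
    show "(\<lambda>U. (U \<inter> V, U \<inter> W)) (case p of (S, T) \<Rightarrow> S \<union> T) = p"
      using ST assms(3) by auto
    have "card (S \<union> T) = card S + card T"
      using ST assms(1-3) by (intro card_Un_disjoint) (auto intro: finite_subset)
    then show "monom 1 (card (case p of (S, T) \<Rightarrow> S \<union> T)) =
        (case p of (S, T) \<Rightarrow> monom (1::real) (card S + card T))"
      by simp
  qed (auto simp: indep_set_def)
  finally show ?thesis ..
qed

lemma indep_gf_UN:
  assumes "finite I" "\<And>i. i \<in> I \<Longrightarrow> finite (V i)"
    and "\<And>i j. i \<in> I \<Longrightarrow> j \<in> I \<Longrightarrow> i \<noteq> j \<Longrightarrow> V i \<inter> V j = {}"
    and "\<And>i j x y. i \<in> I \<Longrightarrow> j \<in> I \<Longrightarrow> i \<noteq> j \<Longrightarrow> x \<in> V i \<Longrightarrow> y \<in> V j \<Longrightarrow> \<not> E x y"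
  shows "indep_gf (\<Union>i\<in>I. V i) E = (\<Prod>i\<in>I. indep_gf (V i) E)"
  using assms
proof (induction I rule: finite_induct)
  case empty
  then show ?case by simp
next
  case (insert i I)
  have "indep_gf (V i \<union> (\<Union>i\<in>I. V i)) E = indep_gf (V i) E * indep_gf (\<Union>i\<in>I. V i) E"
  proof (rule indep_gf_union)
    show "V i \<inter> (\<Union>i\<in>I. V i) = {}"
      using insert.prems(2)[of i] insert.hyps by fastforce
    show "\<not> E x y \<and> \<not> E y x" if "x \<in> V i" "y \<in> (\<Union>i\<in>I. V i)" for x y
      using that insert.prems(3)[of i] insert.prems(3)[of _ i] insert.hyps by fastforce
  qed (use insert in auto)
  also have "indep_gf (\<Union>i\<in>I. V i) E = (\<Prod>i\<in>I. indep_gf (V i) E)"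
  proof (rule insert.IH)
    show "V i' \<inter> V j = {}" if "i' \<in> I" "j \<in> I" "i' \<noteq> j" for i' j
      using that insert.prems(2) by blast
    show "\<not> E x y" if "i' \<in> I" "j \<in> I" "i' \<noteq> j" "x \<in> V i'" "y \<in> V j" for i' j x y
      using that insert.prems(3) by blast
  qed (use insert.prems in auto)
  finally show ?case using insert.hyps by simp
qed

text \<open>The vertex recursion: a set containing \<open>v\<close> is \<open>v\<close> together
  with an independent set avoiding its neighbours.\<close>

lemma indep_gf_insert:
  assumes "finite V" "v \<notin> V" "symp E" "\<not> E v v"
  shows "indep_gf (insert v V) E = indep_gf V E + monom 1 1 * indep_gf {x \<in> V. \<not> E v x} E"
proof -
  let ?W = "{x \<in> V. \<not> E v x}"
  have sym: "E x y \<longleftrightarrow> E y x" for x y using assms(3) by (auto dest: sympD)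
  have split: "{S. indep_set (insert v V) E S} =
      {S. indep_set V E S} \<union> insert v ` {S. indep_set ?W E S}" (is "?A = ?B \<union> ?C")
  proof
    show "?A \<subseteq> ?B \<union> ?C"
    proof
      fix S assume S: "S \<in> ?A"
      show "S \<in> ?B \<union> ?C"
      proof (cases "v \<in> S")
        case True
        then have "indep_set ?W E (S - {v})" using S by (auto simp: indep_set_def)
        moreover have "S = insert v (S - {v})" using True by auto
        ultimately show ?thesis by blast
      next
        case False
        then show ?thesis using S by (auto simp: indep_set_def)
      qed
    qed
    show "?B \<union> ?C \<subseteq> ?A"
      using assms(4) sym by (auto simp: indep_set_def)
  qed
  have inj: "inj_on (insert v) {S. indep_set ?W E S}"
  proof (rule inj_onI)
    fix S T assume "S \<in> {S. indep_set ?W E S}" "T \<in> {S. indep_set ?W E S}" "insert v S = insert v T"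
    moreover then have "v \<notin> S" "v \<notin> T" using assms(2) by (auto simp: indep_set_def)
    ultimately show "S = T" by (metis insert_ident)
  qed
  have card: "card (insert v S) = Suc (card S)" if "indep_set ?W E S" for S
  proof -
    have "finite S" "v \<notin> S"
      using that assms(1,2) by (auto simp: indep_set_def intro: finite_subset)
    then show ?thesis by simp
  qed
  have "indep_gf (insert v V) E =
      indep_gf V E + (\<Sum>S\<in>insert v ` {S. indep_set ?W E S}. monom 1 (card S))"
    unfolding indep_gf_def split
    using assms(1,2) by (intro sum.union_disjoint) (auto simp: finite_indep_sets indep_set_def)
  also have "(\<Sum>S\<in>insert v ` {S. indep_set ?W E S}. monom 1 (card S)) =
      (\<Sum>S | indep_set ?W E S. monom (1::real) (Suc (card S)))"
    using inj by (simp add: sum.reindex card)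
  also have "\<dots> = monom 1 1 * indep_gf ?W E"
    by (simp add: indep_gf_def sum_distrib_left mult_monom)
  finally show ?thesis .
qed

lemma indep_gf_singleton:
  assumes "symp E" "\<not> E x x"
  shows "indep_gf {x} E = [:1, 1:]"
  using indep_gf_insert[of "{}" x E] assms by (simp add: monom_altdef one_pCons)

lemma indep_gf_edge:
  assumes "symp E" "\<not> E x x" "\<not> E y y" "x \<noteq> y" "E x y"
  shows "indep_gf {x, y} E = [:1, 2:]"
proof -
  have *: "{z \<in> {y}. \<not> E x z} = {}" using assms by auto
  show ?thesis
    using indep_gf_insert[of "{y}" x E, unfolded *] indep_gf_singleton[of E y] assms
    by (simp add: monom_altdef)
qed

section \<open>The independence polynomial of the tree\<close>

lemma symp_T3_edge: "symp (T3_edge m n)"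
  by (auto simp: symp_def T3_edge_def)

lemma T3_edge_irrefl: "\<not> T3_edge m n x x"
  by (cases x) (auto simp: T3_edge_def)

lemma indep_gf_T3_legs:
  assumes "i \<in> {1..3}"
  shows "indep_gf (\<Union>j\<in>{1..legs m n i}. {Inner i j, Leaf i j}) (T3_edge m n) = [:1, 2:] ^ legs m n i"
proof -
  have "indep_gf (\<Union>j\<in>{1..legs m n i}. {Inner i j, Leaf i j}) (T3_edge m n) =
      (\<Prod>j\<in>{1..legs m n i}. indep_gf {Inner i j, Leaf i j} (T3_edge m n))"
    by (rule indep_gf_UN) (auto simp: T3_edge_def)
  also have "\<dots> = (\<Prod>j\<in>{1..legs m n i}. [:1, 2:])"
    using assms by (intro prod.cong refl indep_gf_edge symp_T3_edge T3_edge_irrefl) (auto simp: T3_edge_def)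
  finally show ?thesis by simp
qed

lemma indep_gf_T3_spider:
  assumes "i \<in> {1..3}"
  shows "indep_gf (insert (Mid i) (\<Union>j\<in>{1..legs m n i}. {Inner i j, Leaf i j})) (T3_edge m n) =
    spider_poly (legs m n i)"
proof -
  let ?V = "\<Union>j\<in>{1..legs m n i}. {Inner i j, Leaf i j}"
  have W: "{x \<in> ?V. \<not> T3_edge m n (Mid i) x} = (\<Union>j\<in>{1..legs m n i}. {Leaf i j})"
    using assms by (auto simp: T3_edge_def)
  have "indep_gf (\<Union>j\<in>{1..legs m n i}. {Leaf i j}) (T3_edge m n) =
      (\<Prod>j\<in>{1..legs m n i}. indep_gf {Leaf i j} (T3_edge m n))"
    by (rule indep_gf_UN) (auto simp: T3_edge_def)
  also have "\<dots> = [:1, 1:] ^ legs m n i"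
    by (simp add: indep_gf_singleton symp_T3_edge T3_edge_irrefl)
  finally show ?thesis
    using indep_gf_insert[of ?V "Mid i" "T3_edge m n"] indep_gf_T3_legs[OF assms, of m n] W
    by (simp add: symp_T3_edge T3_edge_irrefl)
qed

text \<open>Grouping by branches exposes three spiders with no edges between them once the root is
  removed.\<close>

lemma T3_verts_eq:
  "T3_verts m n = insert Root (\<Union>i\<in>{1..3}. insert (Mid i) (\<Union>j\<in>{1..legs m n i}. {Inner i j, Leaf i j}))"
  unfolding T3_verts_def by auto

lemma finite_T3_verts: "finite (T3_verts m n)"
  unfolding T3_verts_eq by auto

text \<open>Taking the root removes the three centres and leaves \<open>m + n + 3\<close> disjoint
  edges, each contributing \<open>1 + 2t\<close>.\<close>

lemma indep_gf_T3:
  "indep_gf (T3_verts m n) (T3_edge m n) =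
    spider_poly 3 * spider_poly m * spider_poly n + monom 1 1 * [:1, 2:] ^ (m + n + 3)"
proof -
  let ?E = "T3_edge m n"
  let ?L = "\<lambda>i. \<Union>j\<in>{1..legs m n i}. {Inner i j, Leaf i j}"
  let ?V = "\<Union>i\<in>{1..3}. insert (Mid i) (?L i)"
  have I: "{1..3} = {1, 2, 3::nat}" by auto
  have "{x \<in> ?V. \<not> ?E Root x} = (\<Union>i\<in>{1..3}. ?L i)"
    by (auto simp: T3_edge_def)
  then have "indep_gf (T3_verts m n) ?E =
      indep_gf ?V ?E + monom 1 1 * indep_gf (\<Union>i\<in>{1..3}. ?L i) ?E"
    unfolding T3_verts_eq
    by (subst indep_gf_insert) (auto simp: symp_T3_edge T3_edge_irrefl)
  also have "indep_gf ?V ?E = (\<Prod>i\<in>{1..3}. indep_gf (insert (Mid i) (?L i)) ?E)"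
    by (rule indep_gf_UN) (auto simp: T3_edge_def)
  also have "\<dots> = (\<Prod>i\<in>{1..3}. spider_poly (legs m n i))"
    by (intro prod.cong refl indep_gf_T3_spider)
  also have "indep_gf (\<Union>i\<in>{1..3}. ?L i) ?E = (\<Prod>i\<in>{1..3}. indep_gf (?L i) ?E)"
    by (rule indep_gf_UN) (auto simp: T3_edge_def)
  also have "\<dots> = (\<Prod>i\<in>{1..3}. [:1, 2:] ^ legs m n i)"
    by (intro prod.cong refl indep_gf_T3_legs)
  finally show ?thesis
    unfolding I by (simp add: legs_def power_add mult_ac)
qed

section \<open>Unimodality of the tree's polynomial\<close>

lemma unimodal_indep_polyI:
  assumes "finite V"
    and "\<And>i. i < j \<Longrightarrow> coeff (indep_gf V E) i \<le> coeff (indep_gf V E) (Suc i)"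
    and "\<And>i. j \<le> i \<Longrightarrow> coeff (indep_gf V E) (Suc i) \<le> coeff (indep_gf V E) i"
  shows "unimodal_poly (indep_poly V E)"
  unfolding unimodal_poly_def unimodal_seq_def
  \<comment> \<open>The peak \<open>j\<close> may exceed the degree, so it is cut off there.\<close>
  by (rule exI[of _ "min j (degree (indep_poly V E))"])
    (use assms in \<open>auto simp: coeff_indep_gf coeff_indep_poly min_def split: if_splits\<close>)

theorem mainTheorem1:
  fixes m n :: nat
  assumes "m \<ge> 1" and "n \<ge> 1"
  shows "unimodal_poly (indep_poly (T3_verts m n) (T3_edge m n))"
proof -
  let ?N = "m + n + 3"
  let ?F = "spider_poly 3 * spider_poly m * spider_poly n" and ?G = "monom 1 1 * [:1, 2:] ^ ?N :: real poly"
  \<comment> \<open>This is \<open>K - 1\<close> for the \<open>K\<close> of the overview, so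
    \<open>?F\<close> has its peak between \<open>k + 1\<close> and \<open>k + 3\<close>.\<close>
  define k where "k = (2 * ?N + 1) div 3 - 1"
  have k: "Suc k = (2 * ?N + 1) div 3" using assms by (simp add: k_def)
  then have K: "3 * Suc k \<le> 2 * ?N + 1" "2 * ?N \<le> 3 * Suc k + 1" by presburger+
  have "coeff ?F (Suc (Suc k + 2)) \<le> coeff ?F (Suc k + 2)"
    using k assms by (intro spider_product_decr) auto
  then have decr: "coeff ?F (k + 4) \<le> coeff ?F (k + 3)"
    by (simp only: numeral_eq_Suc add_Suc_right add_Suc pred_numeral_simps add_0_right BitM.simps arith_simps)
  obtain q where q: "k + 1 \<le> q" "q \<le> k + 3" "\<And>i. i < q \<Longrightarrow> coeff ?F i \<le> coeff ?F (Suc i)"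
    "\<And>i. q \<le> i \<Longrightarrow> coeff ?F (Suc i) \<le> coeff ?F i"
  proof (rule log_concave_peak[of ?F k])
    show "log_concave ?F" by (intro log_concave_mult log_concave_spider)
    show "coeff ?F k \<le> coeff ?F (Suc k)" by (rule spider_product_incr[OF k])
    show "0 < coeff ?F i" if "i \<le> k + 3" for i
      using that k by (intro spider_product_pos) auto
  qed (use decr in blast)+
  have G: "coeff ?G i = (if i = 0 then 0 else coeff ([:1, 2:] ^ ?N) (i - 1))" for i
    by (simp add: coeff_monom_mult)
  \<comment> \<open>The factor \<open>t\<close> moves the mode \<open>Suc k\<close> of
    \<open>a^N\<close> to \<open>k + 2\<close>, the middle of the three possible peaks of
    \<open>?F\<close>; the two peaks thus differ by at most one.\<close>
  obtain j where j: "\<And>i. i < j \<Longrightarrow> coeff ?F i + coeff ?G i \<le> coeff ?F (Suc i) + coeff ?G (Suc i)"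
    "\<And>i. j \<le> i \<Longrightarrow> coeff ?F (Suc i) + coeff ?G (Suc i) \<le> coeff ?F i + coeff ?G i"
  proof (rule unimodal_add[of q "k + 2" "coeff ?F" "coeff ?G"])
    show "coeff ?G i \<le> coeff ?G (Suc i)" if "i < k + 2" for i
    proof (cases i)
      case (Suc l)
      then have "coeff ([:1, 2:] ^ ?N) l \<le> coeff ([:1, 2::real:] ^ ?N) (Suc l)"
        using that K by (intro coeff_power_incr) simp
      then show ?thesis unfolding G by (simp add: Suc)
    next
      case 0
      then show ?thesis unfolding G by (simp add: coeff_power_nonneg)
    qed
    show "coeff ?G (Suc i) \<le> coeff ?G i" if "k + 2 \<le> i" for i
    proof (cases i)
      case (Suc l)
      then have "coeff ([:1, 2:] ^ ?N) (Suc l) \<le> coeff ([:1, 2::real:] ^ ?N) l"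
        using that K by (intro coeff_power_decr) simp
      then show ?thesis unfolding G by (simp add: Suc)
    qed (use that in simp)
  qed (use q in auto)
  show ?thesis
    by (rule unimodal_indep_polyI[of _ j]) (use j in \<open>simp_all only: finite_T3_verts indep_gf_T3 coeff_add\<close>)
qed

end
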